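(* Let $\Pi_s=(I_N\otimes r_s)S_t$ be the $N^2\times M$ matrix of managed-portfolio returns, built from the signal matrix $S_t\in\mathbb{R}^{N\times M}$ and the vector $r_s\in\mathbb{R}^N$ of subsequently realized excess returns, $s=2,\dots,T+1$, and let $\Lambda\in\mathbb{R}^M$, $\Phi\in\mathbb{R}^{N^2}$ be the parameters of the strategy with return $\pi_s=\Lambda'\Pi_s'\Phi$. Let $C_\Phi=B_\Phi^{-1}A_\Phi$ and $C_\Lambda=B_\Lambda^{-1}A_\Lambda$ be the matrices defined in the context, for which the leading eigenvectors of $C_\Phi\Lambda=\ell\Lambda$ (given $\Phi$) and of $C_\Lambda\Phi=\ell\Phi$ (given $\Lambda$), with $\ell$ the eigenvalue, give the $\Lambda$ and the $\Phi$ that maximize the squared Sharpe ratio of the strategy. (1) Consider the set of managed portfolios $\chi_\Phi$, of dimension $T\times M$, $$\chi_\Phi=\begin{bmatrix}(\chi_\Phi)_2'\\(\chi_\Phi)_3'\\\vdots\\(\chi_\Phi)_{T+1}'\end{bmatrix},\qquad (\chi_\Phi)_s=\Pi_s'\Phi.$$ The eigenvalue problem $C_\Phi\Lambda=\ell\Lambda$ is essentially an asset-allocation exercise: it seeks to maximize the squared Sharpe ratio by investing in $\chi_\Phi$, composed of $M$ assets. This is equivalent to estimating $\Lambda$ as the mean-variance efficient portfolio weights. Following Britten-Jones (1999), the estimate of $\Lambda$ is obtained from the regression $$\mathbf 1=\chi_\Phi\Lambda+\mathbf u,$$ where $\mathbf 1$ is a $T$-vector of ones and $T$ is the sample size. To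 handle high-dimensional settings, ridge regression is adopted, and the estimator for $\Lambda$ is then $$\hat\Lambda=(\chi_\Phi'\chi_\Phi+\lambda I_M)^{-1}\chi_\Phi'\mathbf 1,$$ where $\lambda$ is a ridge-type parameter that shrinks the regression coefficients towards zero. (2) Similarly, define the set of managed portfolios $\chi_\Lambda$, of dimension $T\times N^2$, $$\chi_\Lambda=\begin{bmatrix}(\chi_\Lambda)_2'\\(\chi_\Lambda)_3'\\\vdots\\(\chi_\Lambda)_{T+1}'\end{bmatrix},\qquad (\chi_\Lambda)_s=\Pi_s\Lambda.$$ The eigenvalue problem $C_\Lambda\Phi=\ell\Phi$ is another asset-allocation exercise: it seeks to maximize the squared Sharpe ratio by investing in $\chi_\Lambda$. The estimator for $\Phi$ is $$\hat\Phi=(\chi_\Lambda'\chi_\Lambda+\lambda I_{N^2})^{-1}\chi_\Lambda'\mathbf 1.$$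
   Context: There are $N$ risky assets and $M$ predictive signals per asset. Signals are first observed at $t=1$ and returns are last realized at $T+1$. A prime denotes transpose, $\otimes$ is the Kronecker product, $I_k$ is the $k\times k$ identity matrix, $\mathrm{vec}(X)$ stacks the columns of $X$, and $\mathbf u$ is the $T$-vector of regression errors. The portfolio weights are $\omega_t'=\Lambda'S_t'\Psi$, where $\Psi\in\mathbb{R}^{N\times N}$ is a connection matrix encoding cross-asset predictive influence and $\Phi=\mathrm{vec}(\Psi')$. The squared Sharpe ratio of the strategy is $(E\pi_s)^2/\mathrm{Var}(\pi_s)=\Lambda'A_\Phi\Lambda/\Lambda'B_\Phi\Lambda=\Phi'A_\Lambda\Phi/\Phi'B_\Lambda\Phi$, where, with $\Pi=E[\Pi_s]$, $A_\Phi=\Pi'\Phi\Phi'\Pi$, $B_\Phi=(\Phi'\otimes I_M)\Sigma_\Phi(\Phi\otimes I_M)$, $\Sigma_\Phi$ is the covariance matrix of $\mathrm{vec}(\Pi_s')$, $A_\Lambda=\Pi\Lambda\Lambda'\Pi'$, $B_\Lambda=(\Lambda'\otimes I_{N^2})\Sigma_\Lambda(\Lambda\otimes I_{N^2})$, and $\Sigma_\Lambda$ is the covariance matrix of $\mathrm{vec}(\Pi_s)$. The matrices $C_\Phi=B_\Phi^{-1}A_\Phi$ and $C_\Lambda=B_\Lambda^{-1}A_\Lambda$ presuppose that $B_\Phi$ and $B_\Lambda$ are invertible. The same ridge parameter $\lambda$ is used in both estimators. *)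

theory Defs
  imports "HOL-Probability.Probability"
begin

section \<open>Kronecker product and vectorization\<close>

text \<open>
  A product index \<open>(i, k)\<close> is read with the first component as the slow (block) index. Thus an
  \<open>N\<^sup>2\<close>-vector is an element of \<open>real^('n \<times> 'n)\<close>, and both operations below agree with the usual
  ones under the lexicographic enumeration.
\<close>

definition kron :: "real^'b^'a \<Rightarrow> real^'d^'c \<Rightarrow> real^('b \<times> 'd)^('a \<times> 'c)" where
  "kron A B = (\<chi> p q. A $ fst p $ fst q * B $ snd p $ snd q)"

text \<open>The entry in row \<open>i\<close> and column \<open>j\<close> goes to row \<open>i\<close> of block \<open>j\<close>.\<close>

definition vectorize :: "real^'q^'p \<Rightarrow> real^('q \<times> 'p)" where
  "vectorize X = (\<chi> p. X $ snd p $ fst p)"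

text \<open>
  A Kronecker product with a column vector has column index type \<open>'q \<times> 1\<close> or \<open>1 \<times> 'q\<close>; the
  following two definitions identify it with \<open>'q\<close>.
\<close>

definition kron_col_right :: "real^'q^'p \<Rightarrow> real^'k \<Rightarrow> real^'q^('p \<times> 'k)" where
  "kron_col_right A v = (\<chi> p q. kron A (columnvector v :: real^1^'k) $ p $ (q, 1))"

definition kron_col_left :: "real^'k \<Rightarrow> real^'q^'p \<Rightarrow> real^'q^('k \<times> 'p)" where
  "kron_col_left v A = (\<chi> p q. kron (columnvector v :: real^1^'k) A $ p $ (1, q))"

definition outer :: "real^'k \<Rightarrow> real^'k^'k" where
  "outer v = (columnvector v :: real^1^'k) ** (rowvector v :: real^'k^1)"


section \<open>Moments, Sharpe ratio and mean-variance efficiency\<close>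

definition cov_matrix :: "'a measure \<Rightarrow> ('a \<Rightarrow> real^'k) \<Rightarrow> real^'k^'k" where
  "cov_matrix P X = (\<chi> i j. prob_space.expectation P (\<lambda>\<omega>.
      (X \<omega> $ i - prob_space.expectation P (\<lambda>\<omega>. X \<omega> $ i)) *
      (X \<omega> $ j - prob_space.expectation P (\<lambda>\<omega>. X \<omega> $ j))))"

definition sq_sharpe :: "'a measure \<Rightarrow> ('a \<Rightarrow> real) \<Rightarrow> real" where
  "sq_sharpe P R = (prob_space.expectation P R)\<^sup>2 / prob_space.variance P R"

text \<open>The zero portfolio is excluded, since its Sharpe ratio is undefined.\<close>

definition maximizes_sq_sharpe :: "'a measure \<Rightarrow> (real^'k \<Rightarrow> 'a \<Rightarrow> real) \<Rightarrow> real^'k \<Rightarrow> bool" where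
  "maximizes_sq_sharpe P R w \<longleftrightarrow>
     w \<noteq> 0 \<and> (\<forall>v. v \<noteq> 0 \<longrightarrow> sq_sharpe P (R v) \<le> sq_sharpe P (R w))"

text \<open>
  \<open>X\<close> is the vector of excess returns, so the weights need not sum to one: the remainder is held in
  the riskless asset.
\<close>

definition mv_efficient :: "'a measure \<Rightarrow> ('a \<Rightarrow> real^'k) \<Rightarrow> real^'k \<Rightarrow> bool" where
  "mv_efficient P X w \<longleftrightarrow> \<not> (\<exists>v.
     prob_space.expectation P (\<lambda>\<omega>. X \<omega> \<bullet> w) \<le> prob_space.expectation P (\<lambda>\<omega>. X \<omega> \<bullet> v) \<and>
     prob_space.variance P (\<lambda>\<omega>. X \<omega> \<bullet> v) \<le> prob_space.variance P (\<lambda>\<omega>. X \<omega> \<bullet> w) \<and>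
     (prob_space.expectation P (\<lambda>\<omega>. X \<omega> \<bullet> w) < prob_space.expectation P (\<lambda>\<omega>. X \<omega> \<bullet> v) \<or>
      prob_space.variance P (\<lambda>\<omega>. X \<omega> \<bullet> v) < prob_space.variance P (\<lambda>\<omega>. X \<omega> \<bullet> w)))"

text \<open>
  A data matrix is identified with the empirical distribution of its rows, so that the notions above
  also give the sample moments (with divisor \<open>T\<close>) and sample efficiency.
\<close>

abbreviation sample_cov_matrix :: "real^'k^'t \<Rightarrow> real^'k^'k" where
  "sample_cov_matrix X \<equiv> cov_matrix (uniform_count_measure UNIV) (\<lambda>i. row i X)"

abbreviation sample_mv_efficient :: "real^'k^'t \<Rightarrow> real^'k \<Rightarrow> bool" where
  "sample_mv_efficient X \<equiv> mv_efficient (uniform_count_measure UNIV) (\<lambda>i. row i X)"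


section \<open>Eigenvectors\<close>

definition is_eigenpair :: "real^'k^'k \<Rightarrow> real \<Rightarrow> real^'k \<Rightarrow> bool" where
  "is_eigenpair C l v \<longleftrightarrow> v \<noteq> 0 \<and> C *v v = l *\<^sub>R v"

definition leading_eigenvector :: "real^'k^'k \<Rightarrow> real^'k \<Rightarrow> bool" where
  "leading_eigenvector C v \<longleftrightarrow>
     (\<exists>l. is_eigenpair C l v \<and> (\<forall>k u. is_eigenpair C k u \<longrightarrow> k \<le> l))"


section \<open>Regression\<close>

definition least_squares :: "real^'t \<Rightarrow> real^'k^'t \<Rightarrow> real^'k \<Rightarrow> bool" where
  "least_squares y X b \<longleftrightarrow> is_arg_min (\<lambda>b. (norm (y - X *v b))\<^sup>2) (\<lambda>_. True) b"

definition ridge_regression :: "real \<Rightarrow> real^'t \<Rightarrow> real^'k^'t \<Rightarrow> real^'k \<Rightarrow> bool" where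
  "ridge_regression lam y X b \<longleftrightarrow>
     is_arg_min (\<lambda>b. (norm (y - X *v b))\<^sup>2 + lam * (norm b)\<^sup>2) (\<lambda>_. True) b"

abbreviation ones :: "real^'t" where
  "ones \<equiv> vec 1"

definition ridge_estimator :: "real \<Rightarrow> real^'k^'t \<Rightarrow> real^'k" where
  "ridge_estimator lam X = matrix_inv (transpose X ** X + lam *\<^sub>R mat 1) *v (transpose X *v ones)"


section \<open>The strategy\<close>

text \<open>\<open>r s\<close> are the excess returns realized at \<open>s\<close>, and \<open>S t\<close> the signals observed at \<open>t = s - 1\<close>.\<close>

definition managed :: "(nat \<Rightarrow> 'a \<Rightarrow> real^'n) \<Rightarrow> (nat \<Rightarrow> 'a \<Rightarrow> real^'m^'n) \<Rightarrow> nat \<Rightarrow> 'a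
    \<Rightarrow> real^'m^('n \<times> 'n)" where
  "managed r S s \<omega> = kron_col_right (mat 1 :: real^'n^'n) (r s \<omega>) ** S (s - 1) \<omega>"

definition strategy_return :: "(nat \<Rightarrow> 'a \<Rightarrow> real^'n) \<Rightarrow> (nat \<Rightarrow> 'a \<Rightarrow> real^'m^'n) \<Rightarrow> real^'m
    \<Rightarrow> real^('n \<times> 'n) \<Rightarrow> nat \<Rightarrow> 'a \<Rightarrow> real" where
  "strategy_return r S \<Lambda> \<Phi> s \<omega> = \<Lambda> \<bullet> (transpose (managed r S s \<omega>) *v \<Phi>)"

text \<open>The column vector \<open>\<omega>\<^sub>t\<close> with \<open>\<omega>\<^sub>t' = \<Lambda>' S\<^sub>t' \<Psi>\<close>.\<close>

definition portfolio_weights :: "(nat \<Rightarrow> 'a \<Rightarrow> real^'m^'n) \<Rightarrow> real^'m \<Rightarrow> real^'n^'n \<Rightarrow> nat \<Rightarrow> 'a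
    \<Rightarrow> real^'n" where
  "portfolio_weights S \<Lambda> \<Psi> t \<omega> = \<Lambda> v* (transpose (S t \<omega>) ** \<Psi>)"

text \<open>
  In the matrices below, \<open>Pbar\<close> stands for the mean of the managed returns, and \<open>Sig\<close> for the covariance
  matrix of \<open>vectorize (transpose (managed r S s \<omega>))\<close> and of \<open>vectorize (managed r S s \<omega>)\<close>,
  respectively.
\<close>

definition A_Phi :: "real^'m^('n::finite \<times> 'n) \<Rightarrow> real^('n \<times> 'n) \<Rightarrow> real^'m^'m" where
  "A_Phi Pbar \<Phi> = transpose Pbar ** outer \<Phi> ** Pbar"

definition B_Phi :: "real^(('n::finite \<times> 'n) \<times> 'm)^(('n \<times> 'n) \<times> 'm) \<Rightarrow> real^('n \<times> 'n) \<Rightarrow> real^'m^'m" where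
  "B_Phi Sig \<Phi> =
     transpose (kron_col_left \<Phi> (mat 1 :: real^'m^'m)) ** Sig ** kron_col_left \<Phi> (mat 1)"

definition C_Phi :: "real^'m^('n::finite \<times> 'n) \<Rightarrow> real^(('n \<times> 'n) \<times> 'm)^(('n \<times> 'n) \<times> 'm)
    \<Rightarrow> real^('n \<times> 'n) \<Rightarrow> real^'m^'m" where
  "C_Phi Pbar Sig \<Phi> = matrix_inv (B_Phi Sig \<Phi>) ** A_Phi Pbar \<Phi>"

definition A_Lambda :: "real^'m^('n::finite \<times> 'n) \<Rightarrow> real^'m \<Rightarrow> real^('n \<times> 'n)^('n \<times> 'n)" where
  "A_Lambda Pbar \<Lambda> = Pbar ** outer \<Lambda> ** transpose Pbar"

definition B_Lambda :: "real^('m \<times> ('n::finite \<times> 'n))^('m \<times> ('n \<times> 'n)) \<Rightarrow> real^'m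
    \<Rightarrow> real^('n \<times> 'n)^('n \<times> 'n)" where
  "B_Lambda Sig \<Lambda> =
     transpose (kron_col_left \<Lambda> (mat 1 :: real^('n \<times> 'n)^('n \<times> 'n))) ** Sig ** kron_col_left \<Lambda> (mat 1)"

definition C_Lambda :: "real^'m^('n::finite \<times> 'n) \<Rightarrow> real^('m \<times> ('n \<times> 'n))^('m \<times> ('n \<times> 'n))
    \<Rightarrow> real^'m \<Rightarrow> real^('n \<times> 'n)^('n \<times> 'n)" where
  "C_Lambda Pbar Sig \<Lambda> = matrix_inv (B_Lambda Sig \<Lambda>) ** A_Lambda Pbar \<Lambda>"

text \<open>
  The rows of a data matrix are indexed by a finite linear order \<open>'t\<close> with \<open>T\<close> elements; going through
  it in increasing order, the rows belong to the dates \<open>2, 3, \<dots>, T + 1\<close>.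
\<close>

definition date :: "'t::{finite, linorder} \<Rightarrow> nat" where
  "date i = card {j. j < i} + 2"

definition chi_Phi :: "(nat \<Rightarrow> 'a \<Rightarrow> real^'n) \<Rightarrow> (nat \<Rightarrow> 'a \<Rightarrow> real^'m^'n) \<Rightarrow> real^('n \<times> 'n)
    \<Rightarrow> 'a \<Rightarrow> real^'m^'t::{finite, linorder}" where
  "chi_Phi r S \<Phi> \<omega> = (\<chi> i. transpose (managed r S (date i) \<omega>) *v \<Phi>)"

definition chi_Lambda :: "(nat \<Rightarrow> 'a \<Rightarrow> real^'n) \<Rightarrow> (nat \<Rightarrow> 'a \<Rightarrow> real^'m^'n) \<Rightarrow> real^'m
    \<Rightarrow> 'a \<Rightarrow> real^('n \<times> 'n)^'t::{finite, linorder}" where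
  "chi_Lambda r S \<Lambda> \<omega> = (\<chi> i. managed r S (date i) \<omega> *v \<Lambda>)"

end

(*
  With one parameter fixed, the strategy return is a portfolio return with the other parameter w as
  weights; it has mean m w and variance w' B w, where B is positive definite as an invertible
  covariance matrix.  With b = B^-1 m, completing the square gives
    (m b) (w' B w) = (m w)^2 + (m b) (d' B d),   d = w - ((m w) / (m b)) b,
  so the squared Sharpe ratio is maximal exactly on the line through b, the efficient portfolios
  are the nonnegative multiples of b, and the rank-one matrix B^-1 m m' has b as its leading
  eigenvector.  For the sample, the Gram matrix is X'X = T (B + m m') and X'1 = T m, so the least
  squares coefficient is a positive multiple of b.  Shrinkage: if (G + l1) b1 = (G + l2) b2 with
  l1 < l2 then, for d = b1 - b2, (l2 - l1) d b2 = d' (G + l1) d >= 0, which gives |b2| < |b1|.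
*)

theory Submission
  imports Defs
begin

section \<open>Positive definite matrices and rank-one numerators\<close>

definition pos_def :: "real^'k^'k \<Rightarrow> bool" where
  "pos_def B \<longleftrightarrow> transpose B = B \<and> (\<forall>w. w \<noteq> 0 \<longrightarrow> 0 < w \<bullet> (B *v w))"

lemma inner_symmetric_matrix:
  fixes B :: "real^'k^'k"
  assumes "transpose B = B"
  shows "u \<bullet> (B *v w) = w \<bullet> (B *v u)"
proof -
  have "u \<bullet> (B *v w) = (transpose B *v u) \<bullet> w"
    by (simp add: dot_lmul_matrix)
  then show ?thesis
    by (simp only: assms inner_commute)
qed

text \<open>If \<open>u = B *v w\<close> were nonzero, the form at \<open>w + t *\<^sub>R u\<close>
  would be \<open>2 * t * (u \<bullet> u)\<close> plus a term quadratic in \<open>t\<close>, hence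
  negative for small negative \<open>t\<close>.\<close>

lemma pos_semidef_null_vector:
  fixes B :: "real^'k^'k"
  assumes sym: "transpose B = B" and psd: "\<And>w. 0 \<le> w \<bullet> (B *v w)" and w: "w \<bullet> (B *v w) = 0"
  shows "B *v w = 0"
proof (rule ccontr)
  define u where "u = B *v w"
  define q where "q = u \<bullet> (B *v u)"
  assume "B *v w \<noteq> 0"
  then have u: "u \<bullet> u > 0" by (simp add: u_def)
  have q: "q \<ge> 0" by (simp add: q_def psd)
  have expand: "(w + t *\<^sub>R u) \<bullet> (B *v (w + t *\<^sub>R u)) = 2 * t * (u \<bullet> u) + t\<^sup>2 * q" for t
    using inner_symmetric_matrix[OF sym, of w u] w
    by (simp add: matrix_vector_right_distrib matrix_vector_mult_scaleR inner_add_left inner_add_right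
        q_def power2_eq_square algebra_simps flip: u_def)
  \<comment> \<open>The denominator \<open>q + 1\<close> is positive even when \<open>q = 0\<close>,
    and this \<open>t\<close> turns the form into \<open>- (t\<^sup>2 * (q + 2))\<close>.\<close>
  define t where "t = - (u \<bullet> u) / (q + 1)"
  have uu: "u \<bullet> u = - t * (q + 1)" using q by (simp add: t_def)
  have "2 * t * (u \<bullet> u) + t\<^sup>2 * q = - (t\<^sup>2 * (q + 2))"
    unfolding uu by (simp add: algebra_simps power2_eq_square)
  moreover have "t\<^sup>2 * (q + 2) > 0"
    using u uu q by (auto intro!: mult_pos_pos)
  ultimately show False
    using psd[of "w + t *\<^sub>R u"] expand[of t] by linarith
qed

text \<open>Null vectors of a semidefinite form lie in the kernel of \<open>B\<close>, which is
  trivial. This makes an invertible covariance matrix positive definite.\<close>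

lemma pos_defI_invertible:
  fixes B :: "real^'k^'k"
  assumes "transpose B = B" "\<And>w. 0 \<le> w \<bullet> (B *v w)" "invertible B"
  shows "pos_def B"
  unfolding pos_def_def
proof (intro conjI allI impI)
  fix w :: "real^'k" assume "w \<noteq> 0"
  have "w \<bullet> (B *v w) \<noteq> 0"
  proof
    assume "w \<bullet> (B *v w) = 0"
    then have "B *v w = 0" using pos_semidef_null_vector assms by blast
    then show False
      using \<open>w \<noteq> 0\<close> \<open>invertible B\<close> by (metis invertible_left_inverse matrix_left_invertible_ker)
  qed
  then show "0 < w \<bullet> (B *v w)" using assms(2)[of w] by linarith
qed fact

lemma pos_def_invertible: "pos_def B \<Longrightarrow> invertible B"
  by (metis inner_zero_right invertible_left_inverse less_irrefl matrix_left_invertible_ker pos_def_def)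

text \<open>Trades inverse matrices for linear systems, both for the vector \<open>b\<close> below
  and for the ridge estimator.\<close>

lemma pos_def_solve_iff:
  assumes "pos_def B"
  shows "B *v x = m \<longleftrightarrow> x = matrix_inv B *v m"
proof -
  have "B ** matrix_inv B = mat 1" "matrix_inv B ** B = mat 1"
    using pos_def_invertible[OF assms] by (auto simp: invertible_def matrix_inv_def intro: someI2_ex)
  then show ?thesis
    by (metis matrix_vector_mul_assoc matrix_vector_mul_lid)
qed

section \<open>Rank-one matrices\<close>

lemma outer_mult_vector: "outer v *v x = (v \<bullet> x) *\<^sub>R v"
  by (simp add: outer_def vec_eq_iff matrix_vector_mult_def matrix_matrix_mult_def columnvector_def
      rowvector_def inner_vec_def sum_distrib_left sum_distrib_right algebra_simps)

text \<open>Brings \<open>A_Phi\<close> and \<open>A_Lambda\<close> to the form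
  \<open>outer m\<close>, with \<open>m\<close> the mean vector of the managed portfolios.\<close>

lemma outer_mult_left: "Q ** outer v ** transpose Q = outer (Q *v v)"
proof -
  have "v \<bullet> (x v* Q) = (Q *v v) \<bullet> x" for x
    by (metis dot_lmul_matrix inner_commute)
  then have "(Q ** outer v ** transpose Q) *v x = outer (Q *v v) *v x" for x
    by (simp add: outer_mult_vector matrix_vector_mult_scaleR flip: matrix_vector_mul_assoc)
  then show ?thesis by (simp add: matrix_eq)
qed

text \<open>In the applications \<open>B\<close> is the covariance matrix and \<open>m\<close> the
  mean of a return vector; \<open>b\<close> is then the direction of the tangency portfolio.\<close>

locale rank_one_quotient =
  fixes B :: "real^'k^'k" and m b :: "real^'k"
  assumes pd: "pos_def B"
  defines "b \<equiv> matrix_inv B *v m"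
begin

lemma B_b: "B *v b = m"
  using pos_def_solve_iff[OF pd] b_def by blast

lemma sym: "u \<bullet> (B *v w) = w \<bullet> (B *v u)"
  using pd inner_symmetric_matrix unfolding pos_def_def by blast

lemma pos: "w \<noteq> 0 \<Longrightarrow> 0 < w \<bullet> (B *v w)"
  using pd unfolding pos_def_def by blast

lemma nonneg: "0 \<le> w \<bullet> (B *v w)"
  using pos[of w] by (cases "w = 0") auto

lemma b_pos: "m \<noteq> 0 \<Longrightarrow> 0 < m \<bullet> b"
  using pos[of b] B_b by (metis inner_commute matrix_vector_mult_0_right)

lemma quad_scale_b: "(c *\<^sub>R b) \<bullet> (B *v (c *\<^sub>R b)) = c\<^sup>2 * (m \<bullet> b)"
  by (simp add: matrix_vector_mult_scaleR B_b inner_commute power2_eq_square)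

text \<open>The vector \<open>d\<close> is \<open>v\<close> minus its projection on \<open>b\<close>
  in the inner product given by \<open>B\<close>; the identity is Pythagoras, multiplied by
  \<open>m \<bullet> b\<close>.\<close>

lemma complete_square:
  fixes v
  assumes "m \<noteq> 0"
  defines "d \<equiv> v - ((m \<bullet> v) / (m \<bullet> b)) *\<^sub>R b"
  shows "(m \<bullet> b) * (v \<bullet> (B *v v)) = (m \<bullet> v)\<^sup>2 + (m \<bullet> b) * (d \<bullet> (B *v d))"
proof -
  define t where "t = (m \<bullet> v) / (m \<bullet> b)"
  have t: "t * (m \<bullet> b) = m \<bullet> v" using b_pos[OF assms(1)] by (simp add: t_def)
  have bv: "b \<bullet> (B *v v) = m \<bullet> v" using sym[of b v] by (simp add: B_b inner_commute)
  have d: "d = v - t *\<^sub>R b" by (simp add: d_def t_def)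
  have "d \<bullet> (B *v d) = v \<bullet> (B *v v) - 2 * t * (m \<bullet> v) + t * (t * (m \<bullet> b))"
    using bv by (simp add: d matrix_vector_mult_diff_distrib matrix_vector_mult_scaleR B_b
        inner_diff_left inner_diff_right inner_commute algebra_simps)
  then have vv: "v \<bullet> (B *v v) = d \<bullet> (B *v d) + t * (m \<bullet> v)"
    using t by simp
  show ?thesis
    unfolding vv by (simp add: algebra_simps power2_eq_square flip: t)
qed

lemma cauchy_schwarz: "(m \<bullet> v)\<^sup>2 \<le> (m \<bullet> b) * (v \<bullet> (B *v v))"
proof (cases "m = 0")
  case False
  then show ?thesis
    using complete_square[OF False, of v] b_pos nonneg by (simp add: mult_nonneg_nonneg less_imp_le)
qed simp

lemma cauchy_schwarz_equality:
  assumes "m \<noteq> 0" "(m \<bullet> b) * (v \<bullet> (B *v v)) \<le> (m \<bullet> v)\<^sup>2"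
  shows "v = ((m \<bullet> v) / (m \<bullet> b)) *\<^sub>R b"
proof -
  define d where "d = v - ((m \<bullet> v) / (m \<bullet> b)) *\<^sub>R b"
  have "(m \<bullet> b) * (d \<bullet> (B *v d)) \<le> 0"
    using complete_square[OF assms(1), of v] assms(2) by (simp add: d_def)
  then have "d \<bullet> (B *v d) \<le> 0"
    using b_pos[OF assms(1)] by (simp add: mult_le_0_iff)
  then have "d = 0" using pos[of d] by force
  then show ?thesis by (simp add: d_def)
qed

text \<open>The matrix maps everything to the line of \<open>b\<close>, so its only possible
  eigenvalues are 0 and \<open>m \<bullet> b\<close>, which is positive unless \<open>m = 0\<close>.
  For \<open>m = 0\<close> the matrix vanishes and every nonzero vector is leading.\<close>

lemma leading_eigenvector_iff:
  "leading_eigenvector (matrix_inv B ** outer m) w \<longleftrightarrow> w \<noteq> 0 \<and> (m = 0 \<or> (\<exists>c. w = c *\<^sub>R b))"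
proof -
  have C: "(matrix_inv B ** outer m) *v u = (m \<bullet> u) *\<^sub>R b" for u
    by (simp add: outer_mult_vector matrix_vector_mult_scaleR b_def flip: matrix_vector_mul_assoc)
  note eig = is_eigenpair_def C
  show ?thesis
  proof (cases "m = 0")
    case True
    then have "(matrix_inv B ** outer m) *v u = 0" for u
      by (metis C inner_zero_left scaleR_zero_left)
    then have "leading_eigenvector (matrix_inv B ** outer m) w \<longleftrightarrow> w \<noteq> 0"
      unfolding leading_eigenvector_def is_eigenpair_def by auto
    then show ?thesis using True by simp
  next
    case False
    note k = b_pos[OF False]
    have b0: "b \<noteq> 0" using k by auto
    have top: "l \<le> m \<bullet> b" if "is_eigenpair (matrix_inv B ** outer m) l u" for l u
    proof (cases "m \<bullet> u = 0")
      case True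
      then have "l = 0" using that by (auto simp: eig)
      then show ?thesis using k by simp
    next
      case False
      \<comment> \<open>Pairing the eigenvector equation with \<open>m\<close> allows
        \<open>m \<bullet> u\<close> to be cancelled, which leaves
        \<open>l = m \<bullet> b\<close>.\<close>
      have "m \<bullet> ((m \<bullet> u) *\<^sub>R b) = m \<bullet> (l *\<^sub>R u)" using that by (simp add: eig)
      then show ?thesis using False by simp
    qed
    show ?thesis
    proof
      assume "leading_eigenvector (matrix_inv B ** outer m) w"
      then obtain l where l: "is_eigenpair (matrix_inv B ** outer m) l w"
        and le: "\<And>k u. is_eigenpair (matrix_inv B ** outer m) k u \<Longrightarrow> k \<le> l"
        unfolding leading_eigenvector_def by blast
      \<comment> \<open>Since \<open>b\<close> is itself an eigenvector, the leading eigenvalue is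
        positive, and the equation can be solved for \<open>w\<close>.\<close>
      have "m \<bullet> b \<le> l" by (rule le[of _ b]) (simp add: eig b0)
      then have "l \<noteq> 0" using k by simp
      moreover have "l *\<^sub>R w = (m \<bullet> w) *\<^sub>R b" using l by (simp add: eig)
      ultimately have "w = ((m \<bullet> w) / l) *\<^sub>R b"
        by (metis divide_inverse inverse_eq_divide mult.commute scaleR_one scaleR_scaleR left_inverse)
      then show "w \<noteq> 0 \<and> (m = 0 \<or> (\<exists>c. w = c *\<^sub>R b))" using l by (auto simp: eig)
    next
      assume "w \<noteq> 0 \<and> (m = 0 \<or> (\<exists>c. w = c *\<^sub>R b))"
      then have "is_eigenpair (matrix_inv B ** outer m) (m \<bullet> b) w" using False by (auto simp: eig)
      then show "leading_eigenvector (matrix_inv B ** outer m) w"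
        using top unfolding leading_eigenvector_def by blast
    qed
  qed
qed

lemma leading_eigenvector_exists: "\<exists>w. leading_eigenvector (matrix_inv B ** outer m) w"
proof (cases "m = 0")
  case True
  then have "leading_eigenvector (matrix_inv B ** outer m) (vec 1)"
    by (simp add: leading_eigenvector_iff vec_eq_iff)
  then show ?thesis ..
next
  case False
  then have "leading_eigenvector (matrix_inv B ** outer m) b"
    using b_pos[OF False] by (auto simp: leading_eigenvector_iff intro: exI[of _ 1])
  then show ?thesis ..
qed

text \<open>The right-hand side is that of \<open>leading_eigenvector_iff\<close>, so maximizers and
  leading eigenvectors coincide. The quotient is constant on the line of \<open>b\<close> without 0,
  and Cauchy-Schwarz makes that value the maximum.\<close>

lemma quotient_maximizer_iff:
  "w \<noteq> 0 \<and> (\<forall>v. v \<noteq> 0 \<longrightarrow> (m \<bullet> v)\<^sup>2 / (v \<bullet> (B *v v)) \<le> (m \<bullet> w)\<^sup>2 / (w \<bullet> (B *v w))) \<longleftrightarrow>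
   w \<noteq> 0 \<and> (m = 0 \<or> (\<exists>c. w = c *\<^sub>R b))"
proof (cases "m = 0")
  case False
  note k = b_pos[OF False]
  then have "b \<noteq> 0" by auto
  have attained: "(m \<bullet> (c *\<^sub>R b))\<^sup>2 / ((c *\<^sub>R b) \<bullet> (B *v (c *\<^sub>R b))) = m \<bullet> b" if "c \<noteq> 0" for c
    unfolding quad_scale_b using k that by (simp add: power2_eq_square)
  have bound: "(m \<bullet> v)\<^sup>2 / (v \<bullet> (B *v v)) \<le> m \<bullet> b" if "v \<noteq> 0" for v
    using cauchy_schwarz[of v] pos[OF that] by (simp add: divide_le_eq)
  show ?thesis
  proof (intro conj_cong refl iffI)
    assume "w \<noteq> 0" and max: "\<forall>v. v \<noteq> 0 \<longrightarrow> (m \<bullet> v)\<^sup>2 / (v \<bullet> (B *v v)) \<le> (m \<bullet> w)\<^sup>2 / (w \<bullet> (B *v w))"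
    have "m \<bullet> b \<le> (m \<bullet> w)\<^sup>2 / (w \<bullet> (B *v w))"
      using max \<open>b \<noteq> 0\<close> attained[of 1] by force
    then have "(m \<bullet> b) * (w \<bullet> (B *v w)) \<le> (m \<bullet> w)\<^sup>2"
      using pos[OF \<open>w \<noteq> 0\<close>] by (simp add: le_divide_eq)
    then show "m = 0 \<or> (\<exists>c. w = c *\<^sub>R b)"
      using cauchy_schwarz_equality[OF False] by blast
  next
    assume "w \<noteq> 0" "m = 0 \<or> (\<exists>c. w = c *\<^sub>R b)"
    then obtain c where "w = c *\<^sub>R b" "c \<noteq> 0" using False by auto
    then show "\<forall>v. v \<noteq> 0 \<longrightarrow> (m \<bullet> v)\<^sup>2 / (v \<bullet> (B *v v)) \<le> (m \<bullet> w)\<^sup>2 / (w \<bullet> (B *v w))"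
      using attained bound by simp
  qed
qed simp

text \<open>Equality in Cauchy-Schwarz puts undominated vectors on the line of \<open>b\<close>.
  Only a ray survives: for \<open>m \<noteq> 0\<close>, a negative multiple of \<open>b\<close> has
  a smaller mean than its reflection, at the same variance.\<close>

lemma undominated_iff:
  "\<not> (\<exists>v. m \<bullet> w \<le> m \<bullet> v \<and> v \<bullet> (B *v v) \<le> w \<bullet> (B *v w) \<and>
      (m \<bullet> w < m \<bullet> v \<or> v \<bullet> (B *v v) < w \<bullet> (B *v w))) \<longleftrightarrow> (\<exists>c\<ge>0. w = c *\<^sub>R b)"
  (is "\<not> (\<exists>v. ?dom v) \<longleftrightarrow> _")
proof (cases "m = 0")
  case True
  then have "b = 0" by (simp add: b_def)
  have "\<not> (\<exists>v. ?dom v) \<longleftrightarrow> w = 0"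
  proof
    assume "\<not> (\<exists>v. ?dom v)"
    \<comment> \<open>With all means equal to 0, the zero portfolio dominates anything of positive
      variance.\<close>
    then have "\<not> ?dom 0" by blast
    then show "w = 0" using True pos[of w] by force
  next
    assume "w = 0"
    then show "\<not> (\<exists>v. ?dom v)" using True nonneg by (auto simp: not_less)
  qed
  then show ?thesis using \<open>b = 0\<close> by auto
next
  case False
  note k = b_pos[OF False]
  show ?thesis
  proof
    assume nd: "\<not> (\<exists>v. ?dom v)"
    \<comment> \<open>Chosen so that \<open>c *\<^sub>R b\<close> has the same variance as
      \<open>w\<close>.\<close>
    define c where "c = sqrt ((w \<bullet> (B *v w)) / (m \<bullet> b))"
    have c: "c \<ge> 0" "c\<^sup>2 * (m \<bullet> b) = w \<bullet> (B *v w)"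
      using k nonneg[of w] by (simp_all add: c_def)
    have "(m \<bullet> w)\<^sup>2 \<le> (c * (m \<bullet> b))\<^sup>2"
      using cauchy_schwarz[of w] by (simp add: power2_eq_square algebra_simps flip: c(2))
    then have "\<bar>m \<bullet> w\<bar> \<le> c * (m \<bullet> b)"
      using c(1) k by (metis abs_le_square_iff abs_of_nonneg less_imp_le mult_nonneg_nonneg)
    \<comment> \<open>At equal variance, not being dominated by \<open>c *\<^sub>R b\<close> means
      that the mean of \<open>w\<close> is at least \<open>c * (m \<bullet> b)\<close>;
      Cauchy-Schwarz gives the converse bound.\<close>
    moreover have "\<not> ?dom (c *\<^sub>R b)" using nd by blast
    ultimately have mw: "m \<bullet> w = c * (m \<bullet> b)"
      unfolding quad_scale_b c(2) by auto
    then have "w = ((m \<bullet> w) / (m \<bullet> b)) *\<^sub>R b"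
      by (intro cauchy_schwarz_equality False) (simp add: power2_eq_square algebra_simps flip: c(2))
    then show "\<exists>c\<ge>0. w = c *\<^sub>R b"
      using c(1) k mw by auto
  next
    assume "\<exists>c\<ge>0. w = c *\<^sub>R b"
    then obtain c where c: "c \<ge> 0" "w = c *\<^sub>R b" by blast
    have mw: "m \<bullet> w = c * (m \<bullet> b)" and qw: "w \<bullet> (B *v w) = c\<^sup>2 * (m \<bullet> b)"
      using quad_scale_b[of c] c(2) by simp_all
    show "\<not> (\<exists>v. ?dom v)"
    proof (rule notI, elim exE)
      fix v assume dom: "?dom v"
      \<comment> \<open>The sign of \<open>c\<close> matters here: it permits squaring the
        comparison of means.\<close>
      have "c * (m \<bullet> b) \<ge> 0" using c k by simp
      then have lower: "(c * (m \<bullet> b))\<^sup>2 \<le> (m \<bullet> v)\<^sup>2"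
        using dom mw by (intro power_mono) auto
      have upper: "(m \<bullet> b) * (v \<bullet> (B *v v)) \<le> (c * (m \<bullet> b))\<^sup>2"
      proof -
        have "(m \<bullet> b) * (v \<bullet> (B *v v)) \<le> (m \<bullet> b) * (c\<^sup>2 * (m \<bullet> b))"
          using dom qw k by (intro mult_left_mono) auto
        then show ?thesis by (simp add: power2_eq_square algebra_simps)
      qed
      \<comment> \<open>The bounds and Cauchy-Schwarz form a closed chain of inequalities, so a
        dominating \<open>v\<close> has exactly the mean and variance of \<open>w\<close> and no
        comparison is strict.\<close>
      have eq: "(m \<bullet> v)\<^sup>2 = (c * (m \<bullet> b))\<^sup>2" "(m \<bullet> b) * (v \<bullet> (B *v v)) = (c * (m \<bullet> b))\<^sup>2"
        using lower upper cauchy_schwarz[of v] by linarith+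
      have "m \<bullet> v = c * (m \<bullet> b)"
        using eq(1) dom mw \<open>c * (m \<bullet> b) \<ge> 0\<close> by (simp add: power2_eq_iff_nonneg)
      moreover have "v \<bullet> (B *v v) = c\<^sup>2 * (m \<bullet> b)"
        using eq(2) k by (simp add: power2_eq_square)
      ultimately show False using dom mw qw by simp
    qed
  qed
qed

end

section \<open>First and second moments of portfolio returns\<close>

text \<open>Stated through all portfolio returns rather than componentwise, so that it passes
  directly to linear images; in the second equation the mean inside the variance is already
  evaluated.\<close>

definition has_moments :: "'a measure \<Rightarrow> ('a \<Rightarrow> real^'k) \<Rightarrow> real^'k \<Rightarrow> real^'k^'k \<Rightarrow> bool" where
  "has_moments P X m B \<longleftrightarrow> transpose B = B \<and>
     (\<forall>w. prob_space.expectation P (\<lambda>\<omega>. X \<omega> \<bullet> w) = m \<bullet> w \<and>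
          prob_space.expectation P (\<lambda>\<omega>. (X \<omega> \<bullet> w - m \<bullet> w)\<^sup>2) = w \<bullet> (B *v w))"

text \<open>Expanding the centred square into a double sum leaves only the integrability of the
  products \<open>Y i \<omega> * Y j \<omega>\<close>, which are dominated by sums of
  squares.\<close>

lemma has_moments_square_integrable:
  fixes X :: "'a \<Rightarrow> real^'k"
  assumes "prob_space P"
    and meas: "\<And>i. (\<lambda>\<omega>. X \<omega> $ i) \<in> borel_measurable P"
    and sq: "\<And>i. integrable P (\<lambda>\<omega>. (X \<omega> $ i)\<^sup>2)"
  shows "has_moments P X (\<chi> i. prob_space.expectation P (\<lambda>\<omega>. X \<omega> $ i)) (cov_matrix P X)"
proof -
  interpret prob_space P by fact
  define m where "m = (\<chi> i. expectation (\<lambda>\<omega>. X \<omega> $ i))"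
  define Y where "Y = (\<lambda>i \<omega>. X \<omega> $ i - m $ i)"
  have intX [simp]: "integrable P (\<lambda>\<omega>. X \<omega> $ i)" for i
    using square_integrable_imp_integrable[OF meas sq] .
  have mean: "expectation (\<lambda>\<omega>. X \<omega> \<bullet> w) = m \<bullet> w" for w
    by (simp add: inner_vec_def m_def)
  have Y_meas [measurable]: "Y i \<in> borel_measurable P" for i
    unfolding Y_def using meas by simp
  have Y_sq: "integrable P (\<lambda>\<omega>. (Y i \<omega>)\<^sup>2)" for i
    by (simp add: Y_def power2_diff sq)
  have Y_mult: "integrable P (\<lambda>\<omega>. Y i \<omega> * Y j \<omega>)" for i j
  proof (rule Bochner_Integration.integrable_bound)
    show "integrable P (\<lambda>\<omega>. (Y i \<omega>)\<^sup>2 + (Y j \<omega>)\<^sup>2)"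
      using Y_sq by simp
    have "\<bar>x * y\<bar> \<le> x\<^sup>2 + y\<^sup>2" for x y :: real
      using sum_squares_bound[of "\<bar>x\<bar>" "\<bar>y\<bar>"] mult_nonneg_nonneg[OF abs_ge_zero[of x] abs_ge_zero[of y]]
      unfolding power2_abs mult.assoc abs_mult by linarith
    then show "AE \<omega> in P. norm (Y i \<omega> * Y j \<omega>) \<le> norm ((Y i \<omega>)\<^sup>2 + (Y j \<omega>)\<^sup>2)"
      by simp
  qed measurable
  have cov: "cov_matrix P X $ i $ j = expectation (\<lambda>\<omega>. Y i \<omega> * Y j \<omega>)" for i j
    by (simp add: cov_matrix_def Y_def m_def)
  have "expectation (\<lambda>\<omega>. (X \<omega> \<bullet> w - m \<bullet> w)\<^sup>2) = w \<bullet> (cov_matrix P X *v w)" for w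
  proof -
    have "(X \<omega> \<bullet> w - m \<bullet> w)\<^sup>2 = (\<Sum>i\<in>UNIV. \<Sum>j\<in>UNIV. w $ i * w $ j * (Y i \<omega> * Y j \<omega>))" for \<omega>
    proof -
      have "X \<omega> \<bullet> w - m \<bullet> w = (\<Sum>i\<in>UNIV. w $ i * Y i \<omega>)"
        by (simp add: inner_vec_def Y_def algebra_simps sum_subtractf)
      then show ?thesis
        by (simp add: power2_eq_square sum_product algebra_simps)
    qed
    then have "expectation (\<lambda>\<omega>. (X \<omega> \<bullet> w - m \<bullet> w)\<^sup>2) =
        (\<Sum>i\<in>UNIV. \<Sum>j\<in>UNIV. w $ i * w $ j * cov_matrix P X $ i $ j)"
      using Y_mult by (simp add: cov)
    then show ?thesis
      by (simp add: inner_vec_def matrix_vector_mult_def sum_distrib_left algebra_simps)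
  qed
  moreover have "transpose (cov_matrix P X) = cov_matrix P X"
    by (simp add: vec_eq_iff transpose_def cov mult.commute)
  ultimately show ?thesis
    by (simp add: has_moments_def mean flip: m_def)
qed

text \<open>Weights \<open>w\<close> on \<open>L *v X \<omega>\<close> act as weights
  \<open>w v* L\<close> on \<open>X \<omega>\<close>.\<close>

lemma has_moments_linear_image:
  fixes L :: "real^'k^'l"
  assumes "has_moments P X m B"
  shows "has_moments P (\<lambda>\<omega>. L *v X \<omega>) (L *v m) (L ** B ** transpose L)"
proof -
  have "(L *v x) \<bullet> w = x \<bullet> (w v* L)" for x w
    by (metis dot_lmul_matrix inner_commute)
  moreover have "w \<bullet> ((L ** B ** transpose L) *v w) = (w v* L) \<bullet> (B *v (w v* L))" for w
    by (simp add: dot_lmul_matrix flip: matrix_vector_mul_assoc)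
  ultimately show ?thesis
    using assms by (simp add: has_moments_def matrix_transpose_mul matrix_mul_assoc)
qed

lemma has_moments_pos_def:
  assumes "has_moments P X m B" "invertible B"
  shows "pos_def B"
proof (rule pos_defI_invertible)
  fix w
  have "w \<bullet> (B *v w) = prob_space.expectation P (\<lambda>\<omega>. (X \<omega> \<bullet> w - m \<bullet> w)\<^sup>2)"
    using assms(1) by (simp add: has_moments_def)
  then show "0 \<le> w \<bullet> (B *v w)" by simp
qed (use assms in \<open>auto simp: has_moments_def\<close>)

section \<open>Efficiency, Sharpe ratio and eigenvectors for a general return vector\<close>

lemma mv_efficient_iff:
  assumes "has_moments P X m B" "pos_def B"
  shows "mv_efficient P X w \<longleftrightarrow> (\<exists>c\<ge>0. w = c *\<^sub>R (matrix_inv B *v m))"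
proof -
  interpret rank_one_quotient B m "matrix_inv B *v m"
    by unfold_locales fact
  show ?thesis
    using undominated_iff[of w] assms(1) by (simp add: mv_efficient_def has_moments_def)
qed

text \<open>Supplies the population claims for both parameters. Leading eigenvectors fill a line,
  efficient portfolios only a ray, hence the two signs in the last claim; for \<open>m = 0\<close>
  every nonzero vector is leading but only 0 is efficient.\<close>

lemma leading_eigenvector_characterization:
  assumes mom: "has_moments P X m B" and inv: "invertible B"
  shows "\<exists>w. leading_eigenvector (matrix_inv B ** outer m) w"
    and "sq_sharpe P (\<lambda>\<omega>. X \<omega> \<bullet> w) = (w \<bullet> (outer m *v w)) / (w \<bullet> (B *v w))"
    and "leading_eigenvector (matrix_inv B ** outer m) w \<longleftrightarrow>
      maximizes_sq_sharpe P (\<lambda>w \<omega>. X \<omega> \<bullet> w) w"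
    and "m \<noteq> 0 \<Longrightarrow> leading_eigenvector (matrix_inv B ** outer m) w \<longleftrightarrow>
      w \<noteq> 0 \<and> (mv_efficient P X w \<or> mv_efficient P X (- w))"
proof -
  have pd: "pos_def B" using has_moments_pos_def[OF mom inv] .
  interpret rank_one_quotient B m "matrix_inv B *v m"
    by unfold_locales fact
  show "\<exists>w. leading_eigenvector (matrix_inv B ** outer m) w"
    by (rule leading_eigenvector_exists)
  have sharpe: "sq_sharpe P (\<lambda>\<omega>. X \<omega> \<bullet> w) = (m \<bullet> w)\<^sup>2 / (w \<bullet> (B *v w))" for w
    using mom by (simp add: sq_sharpe_def has_moments_def)
  then show "sq_sharpe P (\<lambda>\<omega>. X \<omega> \<bullet> w) = (w \<bullet> (outer m *v w)) / (w \<bullet> (B *v w))"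
    by (simp add: outer_mult_vector inner_commute power2_eq_square)
  show "leading_eigenvector (matrix_inv B ** outer m) w \<longleftrightarrow>
      maximizes_sq_sharpe P (\<lambda>w \<omega>. X \<omega> \<bullet> w) w"
    unfolding maximizes_sq_sharpe_def sharpe quotient_maximizer_iff leading_eigenvector_iff ..
  have "(\<exists>c. w = c *\<^sub>R b) \<longleftrightarrow> (\<exists>c\<ge>0. w = c *\<^sub>R b) \<or> (\<exists>c\<ge>0. - w = c *\<^sub>R b)" for b :: "real^'b"
  proof
    assume "\<exists>c. w = c *\<^sub>R b"
    then obtain c where "w = c *\<^sub>R b" ..
    then show "(\<exists>c\<ge>0. w = c *\<^sub>R b) \<or> (\<exists>c\<ge>0. - w = c *\<^sub>R b)"
      by (cases "c \<ge> 0") (auto intro: exI[of _ "- c"])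
  qed (metis minus_equation_iff scaleR_minus_left)
  then show "leading_eigenvector (matrix_inv B ** outer m) w \<longleftrightarrow>
      w \<noteq> 0 \<and> (mv_efficient P X w \<or> mv_efficient P X (- w))" if "m \<noteq> 0"
    unfolding leading_eigenvector_iff mv_efficient_iff[OF mom pd] using that by blast
qed

section \<open>Ridge regression\<close>

text \<open>The objective is a convex quadratic whose expansion around \<open>b\<close> is exact, so
  \<open>b\<close> is minimal exactly when the gradient vanishes. The value \<open>lam = 0\<close>
  is included for ordinary least squares.\<close>

lemma ridge_regression_iff_normal_equation:
  fixes X :: "real^'k^'t"
  assumes "0 \<le> lam"
  shows "ridge_regression lam y X b \<longleftrightarrow> (transpose X ** X + lam *\<^sub>R mat 1) *v b = transpose X *v y"
proof -
  define f where "f b = (norm (y - X *v b))\<^sup>2 + lam * (norm b)\<^sup>2" for b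
  \<comment> \<open>Half the gradient of \<open>f\<close> at \<open>b\<close>.\<close>
  define g where "g = (transpose X ** X + lam *\<^sub>R mat 1) *v b - transpose X *v y"
  have g: "g = transpose X *v (X *v b) + lam *\<^sub>R b - transpose X *v y"
    by (simp add: g_def matrix_vector_mult_add_rdistrib scaleR_matrix_vector_assoc[symmetric]
        flip: matrix_vector_mul_assoc)
  have expand: "f (b + h) = f b + 2 * (h \<bullet> g) + ((norm (X *v h))\<^sup>2 + lam * (norm h)\<^sup>2)" for h
  proof -
    have "h \<bullet> (transpose X *v z) = (X *v h) \<bullet> z" for z
      by (metis dot_lmul_matrix inner_commute transpose_matrix_vector)
    then have "h \<bullet> g = (X *v h) \<bullet> (X *v b - y) + lam * (h \<bullet> b)"
      unfolding g by (simp only: inner_add_right inner_diff_right inner_scaleR_right)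
    then show ?thesis
      by (simp add: f_def power2_norm_eq_inner matrix_vector_right_distrib inner_add_left inner_add_right
          inner_diff_left inner_diff_right inner_commute algebra_simps)
  qed
  have "is_arg_min f (\<lambda>_. True) b \<longleftrightarrow> g = 0"
  proof
    assume "g = 0"
    then have "f b \<le> f z" for z
      using expand[of "z - b"] assms by simp
    then show "is_arg_min f (\<lambda>_. True) b" by (simp add: is_arg_min_def not_less)
  next
    assume min: "is_arg_min f (\<lambda>_. True) b"
    define q where "q = (norm (X *v g))\<^sup>2 + lam * (norm g)\<^sup>2"
    have q: "q \<ge> 0" using assms by (simp add: q_def)
    \<comment> \<open>A step against the gradient, with \<open>q + 1\<close> again avoiding division
      by zero; it lowers \<open>f\<close> by \<open>t\<^sup>2 * (q + 2)\<close>.\<close>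
    define t where "t = - (g \<bullet> g) / (q + 1)"
    have gg: "g \<bullet> g = - t * (q + 1)" using q by (simp add: t_def)
    have "f b \<le> f (b + t *\<^sub>R g)"
      using min by (simp add: is_arg_min_def not_less)
    also have "f (b + t *\<^sub>R g) = f b + 2 * t * (g \<bullet> g) + t\<^sup>2 * q"
      by (simp add: expand q_def matrix_vector_mult_scaleR power_mult_distrib algebra_simps)
    also have "\<dots> = f b - t\<^sup>2 * (q + 2)"
      unfolding gg by (simp add: algebra_simps power2_eq_square)
    finally have "t\<^sup>2 * (q + 2) \<le> 0" by simp
    then have "t = 0" using q by (simp add: mult_le_0_iff)
    then show "g = 0" using gg by simp
  qed
  then show ?thesis
    unfolding ridge_regression_def f_def[abs_def] g_def by simp
qed

lemma least_squares_eq_ridge_regression: "least_squares y X = ridge_regression 0 y X"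
  by (simp add: fun_eq_iff least_squares_def ridge_regression_def)

section \<open>Uniqueness and shrinkage of the ridge estimator\<close>

lemma ridge_quadratic_form:
  fixes X :: "real^'k^'t"
  shows "w \<bullet> ((transpose X ** X + lam *\<^sub>R mat 1) *v w) = (norm (X *v w))\<^sup>2 + lam * (norm w)\<^sup>2"
proof -
  have "w \<bullet> (transpose X *v (X *v w)) = (X *v w) \<bullet> (X *v w)"
    by (metis dot_lmul_matrix inner_commute transpose_matrix_vector)
  then show ?thesis
    by (simp add: matrix_vector_mult_add_rdistrib scaleR_matrix_vector_assoc[symmetric] inner_add_right
        power2_norm_eq_inner del: transpose_matrix_vector flip: matrix_vector_mul_assoc)
qed

text \<open>The penalty alone makes the form positive, even if \<open>transpose X ** X\<close> is
  singular, as with more portfolios than dates.\<close>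

lemma pos_def_ridge:
  fixes X :: "real^'k^'t"
  assumes "0 < lam"
  shows "pos_def (transpose X ** X + lam *\<^sub>R mat 1)"
  unfolding pos_def_def
proof (intro conjI allI impI)
  show "transpose (transpose X ** X + lam *\<^sub>R mat 1) = transpose X ** X + lam *\<^sub>R mat 1"
    by (simp add: vec_eq_iff transpose_def matrix_matrix_mult_def mat_def mult.commute)
qed (use assms in \<open>auto simp: ridge_quadratic_form intro!: add_nonneg_pos mult_pos_pos\<close>)

lemma ridge_normal_equation_iff:
  assumes "0 < lam"
  shows "(transpose X ** X + lam *\<^sub>R mat 1) *v b = transpose X *v ones \<longleftrightarrow> b = ridge_estimator lam X"
  unfolding ridge_estimator_def by (rule pos_def_solve_iff[OF pos_def_ridge[OF assms]])

lemma ridge_regression_iff: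
  "0 < lam \<Longrightarrow> ridge_regression lam ones X b \<longleftrightarrow> b = ridge_estimator lam X"
  by (simp only: ridge_regression_iff_normal_equation[OF less_imp_le] ridge_normal_equation_iff)

text \<open>Stated for solutions of the normal equations, so that \<open>l1 = 0\<close> covers every
  least squares solution, unique or not.\<close>

lemma ridge_norm_strict_antimono:
  fixes X :: "real^'k^'t"
  assumes "0 \<le> l1" "l1 < l2" "transpose X *v y \<noteq> 0"
    and b1: "(transpose X ** X + l1 *\<^sub>R mat 1) *v b1 = transpose X *v y"
    and b2: "(transpose X ** X + l2 *\<^sub>R mat 1) *v b2 = transpose X *v y"
  shows "norm b2 < norm b1"
proof -
  define d where "d = b1 - b2"
  have shift: "(transpose X ** X + l2 *\<^sub>R mat 1) *v b2 =
      (transpose X ** X + l1 *\<^sub>R mat 1) *v b2 + (l2 - l1) *\<^sub>R b2"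
    by (simp add: matrix_vector_mult_add_rdistrib scaleR_matrix_vector_assoc[symmetric] scaleR_diff_left)
  have diff: "(transpose X ** X + l1 *\<^sub>R mat 1) *v d = (l2 - l1) *\<^sub>R b2"
    unfolding d_def matrix_vector_mult_diff_distrib b1 using b2 shift
    by (metis add_diff_cancel_left')
  have "0 \<le> d \<bullet> ((transpose X ** X + l1 *\<^sub>R mat 1) *v d)"
    unfolding ridge_quadratic_form using assms(1) by simp
  then have "0 \<le> d \<bullet> b2"
    unfolding diff using assms(2) by (simp add: zero_le_mult_iff)
  \<comment> \<open>This is the source of strictness: equal solutions would both be 0, against
    \<open>transpose X *v y \<noteq> 0\<close>.\<close>
  moreover have "d \<noteq> 0"
  proof
    assume "d = 0"
    then have "b2 = 0" using diff assms(2) by simp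
    then show False using b2 assms(3) by simp
  qed
  moreover have "(norm b1)\<^sup>2 = (norm b2)\<^sup>2 + 2 * (d \<bullet> b2) + (norm d)\<^sup>2"
    by (simp add: d_def power2_norm_eq_inner inner_diff_left inner_diff_right inner_commute)
  ultimately have "(norm b2)\<^sup>2 < (norm b1)\<^sup>2"
    by (simp add: add_nonneg_pos)
  then show ?thesis
    by (rule power2_less_imp_less) simp
qed

text \<open>Pair the normal equation with its solution, drop the square of the fitted values and
  apply Cauchy-Schwarz.\<close>

lemma norm_ridge_estimator_le:
  assumes "0 < lam"
  shows "norm (ridge_estimator lam X) \<le> norm (transpose X *v ones) / lam"
proof -
  define b where "b = ridge_estimator lam X"
  define y where "y = transpose X *v ones"
  have "(transpose X ** X + lam *\<^sub>R mat 1) *v b = y"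
    unfolding b_def y_def using ridge_normal_equation_iff[OF assms] by blast
  then have "lam * (norm b)\<^sup>2 \<le> b \<bullet> y"
    using ridge_quadratic_form[of b X lam] by simp
  also have "\<dots> \<le> norm b * norm y"
    by (rule norm_cauchy_schwarz)
  finally have "norm b * (lam * norm b) \<le> norm b * norm y"
    by (simp add: power2_eq_square algebra_simps)
  then have "lam * norm b \<le> norm y"
    by (cases "b = 0") auto
  then show ?thesis
    unfolding b_def[symmetric] y_def[symmetric] using assms by (simp add: le_divide_eq mult.commute)
qed

lemma ridge_estimator_tendsto_0: "((\<lambda>lam. ridge_estimator lam X) \<longlongrightarrow> 0) at_top"
proof (rule Lim_null_comparison)
  show "eventually (\<lambda>lam. norm (ridge_estimator lam X) \<le> norm (transpose X *v ones) / lam) at_top"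
    using eventually_gt_at_top[of 0] by eventually_elim (rule norm_ridge_estimator_le)
  show "((\<lambda>lam. norm (transpose X *v ones) / lam) \<longlongrightarrow> 0) at_top"
    by (rule tendsto_divide_0[OF tendsto_const filterlim_at_top_imp_at_infinity[OF filterlim_ident]])
qed

lemma ridge_shrinkage:
  assumes "0 < lam" "transpose X *v ones \<noteq> 0"
  shows "least_squares ones X b \<Longrightarrow> norm (ridge_estimator lam X) < norm b"
    and "lam < lam' \<Longrightarrow> norm (ridge_estimator lam' X) < norm (ridge_estimator lam X)"
proof -
  note norm_less = ridge_norm_strict_antimono[OF _ _ assms(2)]
  note normal_eq = ridge_normal_equation_iff[THEN iffD2, OF _ refl]
  show "norm (ridge_estimator lam X) < norm b" if "least_squares ones X b"
    using that assms(1)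
    by (intro norm_less[OF order_refl assms(1) _ normal_eq])
      (simp_all only: least_squares_eq_ridge_regression ridge_regression_iff_normal_equation[OF order_refl])
  show "norm (ridge_estimator lam' X) < norm (ridge_estimator lam X)" if "lam < lam'"
    using that assms(1) by (intro norm_less[OF _ that normal_eq normal_eq]) simp_all
qed

section \<open>Regressing a constant on sample returns\<close>

lemma transpose_mult_ones_nth: "(transpose X *v ones) $ i = (\<Sum>t\<in>UNIV. X $ t $ i)"
  for X :: "real^'k^'t"
  by (simp add: vector_matrix_mult_def)

text \<open>Under the uniform measure on the rows every function is integrable, and
  \<open>transpose X *v ones\<close> lists the column sums; the population lemmas thus apply to
  samples.\<close>

lemma sample_has_moments:
  fixes X :: "real^'k^'t"
  shows "has_moments (uniform_count_measure UNIV) (\<lambda>t. row t X)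
    ((1 / real CARD('t)) *\<^sub>R (transpose X *v ones)) (sample_cov_matrix X)"
proof -
  have "has_moments (uniform_count_measure UNIV) (\<lambda>t. row t X)
      (\<chi> i. prob_space.expectation (uniform_count_measure UNIV) (\<lambda>t. row t X $ i)) (sample_cov_matrix X)"
  proof (rule has_moments_square_integrable)
    show "prob_space (uniform_count_measure (UNIV :: 't set))"
      by (rule prob_space_uniform_count_measure) auto
  qed (auto simp: uniform_count_measure_def integrable_point_measure_finite)
  also have "(\<chi> i. prob_space.expectation (uniform_count_measure UNIV) (\<lambda>t. row t X $ i)) =
      (1 / real CARD('t)) *\<^sub>R (transpose X *v ones)"
    unfolding vec_eq_iff vector_scaleR_component transpose_mult_ones_nth
    by (simp add: integral_uniform_count_measure row_def)
  finally show ?thesis .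
qed

text \<open>Up to the factor \<open>T\<close>, the Gram matrix is the uncentred second moment, that
  is, covariance plus the outer square of the mean.\<close>

lemma gram_matrix_eq:
  fixes X :: "real^'k^'t"
  defines "m \<equiv> (1 / real CARD('t)) *\<^sub>R (transpose X *v ones)"
  shows "transpose X ** X = real CARD('t) *\<^sub>R (sample_cov_matrix X + outer m)"
proof -
  define n where "n = real CARD('t)"
  have n: "n > 0" by (simp add: n_def)
  have m: "(\<Sum>t\<in>UNIV. X $ t $ i) = n * m $ i" for i
    unfolding m_def vector_scaleR_component transpose_mult_ones_nth n_def by simp
  have "sample_cov_matrix X $ i $ j = (\<Sum>t\<in>UNIV. (X $ t $ i - m $ i) * (X $ t $ j - m $ j)) / n" for i j
    using n by (simp add: cov_matrix_def integral_uniform_count_measure row_def m flip: n_def)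
  moreover have "(\<Sum>t\<in>UNIV. (X $ t $ i - m $ i) * (X $ t $ j - m $ j)) =
      (\<Sum>t\<in>UNIV. X $ t $ i * X $ t $ j) - n * (m $ i * m $ j)" for i j
  proof -
    have "(\<Sum>t\<in>UNIV. (X $ t $ i - m $ i) * (X $ t $ j - m $ j)) =
      (\<Sum>t\<in>UNIV. X $ t $ i * X $ t $ j) - m $ j * (\<Sum>t\<in>UNIV. X $ t $ i)
        - m $ i * (\<Sum>t\<in>UNIV. X $ t $ j) + n * (m $ i * m $ j)"
      by (simp add: algebra_simps sum_subtractf sum.distrib sum_distrib_left n_def)
    then show ?thesis by (simp add: m algebra_simps)
  qed
  moreover have "outer m $ i $ j = m $ i * m $ j" for i j
    by (simp add: outer_def matrix_matrix_mult_def columnvector_def rowvector_def)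
  ultimately have "(transpose X ** X) $ i $ j = (n *\<^sub>R (sample_cov_matrix X + outer m)) $ i $ j" for i j
    using n by (simp add: matrix_matrix_mult_def transpose_def field_simps)
  then show ?thesis by (simp add: vec_eq_iff n_def)
qed

text \<open>
  With mean \<open>m\<close> and covariance matrix \<open>B\<close> of the rows, the normal equation reads
  \<open>(B + m m') w = m\<close>, so by Sherman--Morrison \<open>w = B\<^sup>-\<^sup>1 m / (1 + m' B\<^sup>-\<^sup>1 m)\<close>.
\<close>

lemma least_squares_ones_mv_efficient:
  fixes X :: "real^'k^'t"
  assumes "invertible (sample_cov_matrix X)"
  shows "\<exists>b. (\<forall>w. least_squares ones X w \<longleftrightarrow> w = b) \<and>
    (\<forall>w. sample_mv_efficient X w \<longleftrightarrow> (\<exists>c\<ge>0. w = c *\<^sub>R b))"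
proof -
  define n where "n = real CARD('t)"
  define B where "B = sample_cov_matrix X"
  define m where "m = (1 / n) *\<^sub>R (transpose X *v ones)"
  define b where "b = matrix_inv B *v m"
  have n: "n > 0" by (simp add: n_def)
  have mom: "has_moments (uniform_count_measure UNIV) (\<lambda>t. row t X) m B"
    unfolding m_def B_def n_def by (rule sample_has_moments)
  have pd: "pos_def B"
    using has_moments_pos_def[OF mom] assms by (simp add: B_def)
  interpret rank_one_quotient B m b
    by unfold_locales (fact pd, simp add: b_def)
  have gram: "transpose X ** X = n *\<^sub>R (B + outer m)"
    unfolding n_def B_def m_def by (rule gram_matrix_eq)
  have normal_eq: "(transpose X ** X + 0 *\<^sub>R mat 1) *v w = n *\<^sub>R (B *v w + (m \<bullet> w) *\<^sub>R m)" for w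
    by (simp add: gram outer_mult_vector matrix_vector_mult_add_rdistrib flip: scaleR_matrix_vector_assoc)
  have rhs: "transpose X *v ones = n *\<^sub>R m"
    using n by (simp add: m_def)
  have k: "1 + m \<bullet> b > 0"
    using b_pos by (cases "m = 0") (auto intro: add_pos_pos)
  have ls: "least_squares ones X w \<longleftrightarrow> w = (1 / (1 + m \<bullet> b)) *\<^sub>R b" for w
  proof -
    have "least_squares ones X w \<longleftrightarrow> B *v w + (m \<bullet> w) *\<^sub>R m = m"
      unfolding least_squares_eq_ridge_regression ridge_regression_iff_normal_equation[OF order_refl]
        normal_eq rhs using n by simp
    also have "\<dots> \<longleftrightarrow> B *v w = (1 - m \<bullet> w) *\<^sub>R m"
      by (simp add: scaleR_diff_left eq_diff_eq)
    also have "\<dots> \<longleftrightarrow> w = (1 - m \<bullet> w) *\<^sub>R b"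
      by (simp add: pos_def_solve_iff[OF pd] matrix_vector_mult_scaleR b_def)
    also have "\<dots> \<longleftrightarrow> w = (1 / (1 + m \<bullet> b)) *\<^sub>R b"
    proof
      assume w: "w = (1 - m \<bullet> w) *\<^sub>R b"
      \<comment> \<open>Pairing with \<open>m\<close> reduces the fixed-point equation for
        \<open>w\<close> to a scalar equation for \<open>m \<bullet> w\<close>.\<close>
      then have "m \<bullet> w = (1 - m \<bullet> w) * (m \<bullet> b)" by (metis inner_scaleR_right)
      then have "1 - m \<bullet> w = 1 / (1 + m \<bullet> b)" using k by (simp add: field_simps)
      then show "w = (1 / (1 + m \<bullet> b)) *\<^sub>R b" using w by simp
    next
      assume w: "w = (1 / (1 + m \<bullet> b)) *\<^sub>R b"
      then have "1 - m \<bullet> w = 1 / (1 + m \<bullet> b)" using k by (simp add: field_simps)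
      then show "w = (1 - m \<bullet> w) *\<^sub>R b" using w by simp
    qed
    finally show ?thesis .
  qed
  \<comment> \<open>Rescaling \<open>b\<close> by a positive factor leaves its ray
    unchanged.\<close>
  have "sample_mv_efficient X w \<longleftrightarrow> (\<exists>c\<ge>0. w = c *\<^sub>R ((1 / (1 + m \<bullet> b)) *\<^sub>R b))" for w
    unfolding mv_efficient_iff[OF mom pd, folded b_def]
  proof safe
    fix c :: real assume "c \<ge> 0"
    then show "\<exists>c'\<ge>0. c *\<^sub>R b = c' *\<^sub>R ((1 / (1 + m \<bullet> b)) *\<^sub>R b)"
      using k by (intro exI[of _ "c * (1 + m \<bullet> b)"]) auto
    show "\<exists>c'\<ge>0. c *\<^sub>R ((1 / (1 + m \<bullet> b)) *\<^sub>R b) = c' *\<^sub>R b"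
      using k \<open>c \<ge> 0\<close> by (intro exI[of _ "c / (1 + m \<bullet> b)"]) auto
  qed
  with ls show ?thesis by blast
qed

section \<open>Managed portfolios\<close>

lemma sum_UNIV_prod: "(\<Sum>p\<in>UNIV. f p) = (\<Sum>i\<in>UNIV. \<Sum>k\<in>UNIV. f (i, k))"
  for f :: "'a::finite \<times> 'b::finite \<Rightarrow> 'c::comm_monoid_add"
  by (simp add: sum.cartesian_product flip: UNIV_Times_UNIV)

text \<open>The identity factor collapses the matrix product to signal row \<open>fst p\<close>;
  \<open>snd p\<close> selects the return that multiplies it.\<close>

lemma managed_nth: "managed r S s \<omega> $ p $ j = r s \<omega> $ snd p * S (s - 1) \<omega> $ fst p $ j"
proof -
  have "managed r S s \<omega> $ p $ j =
      (\<Sum>l\<in>UNIV. kron_col_right (mat 1) (r s \<omega>) $ p $ l * S (s - 1) \<omega> $ l $ j)"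
    by (simp add: managed_def matrix_matrix_mult_def)
  also have "\<dots> = (\<Sum>l\<in>UNIV. if l = fst p then r s \<omega> $ snd p * S (s - 1) \<omega> $ l $ j else 0)"
    by (rule sum.cong) (auto simp: kron_col_right_def kron_def columnvector_def mat_def)
  finally show ?thesis by simp
qed

text \<open>Exhibits \<open>Y *v v\<close> as a linear image of \<open>vectorize Y\<close>, which
  explains the sandwich form of \<open>B_Phi\<close> and \<open>B_Lambda\<close>.\<close>

lemma transpose_kron_col_left_vectorize:
  fixes Y :: "real^'q^'p"
  shows "transpose (kron_col_left v (mat 1)) *v vectorize Y = Y *v v"
proof -
  have "(transpose (kron_col_left v (mat 1)) *v vectorize Y) $ j =
      (\<Sum>a\<in>UNIV. \<Sum>b\<in>UNIV. v $ a * mat 1 $ b $ j * Y $ b $ a)" for j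
    unfolding matrix_vector_mult_def
    by (simp add: sum_UNIV_prod transpose_def kron_col_left_def kron_def columnvector_def vectorize_def)
  moreover have "(\<Sum>b\<in>UNIV. v $ a * mat 1 $ b $ j * Y $ b $ a) =
      (\<Sum>b\<in>UNIV. if b = j then Y $ b $ a * v $ a else 0)" for a j
    by (rule sum.cong) (auto simp: mat_def)
  ultimately have "(transpose (kron_col_left v (mat 1)) *v vectorize Y) $ j =
      (\<Sum>a\<in>UNIV. Y $ j $ a * v $ a)" for j
    by simp
  then show ?thesis
    by (simp add: vec_eq_iff matrix_vector_mult_def)
qed

lemma has_moments_matrix_mult:
  fixes M :: "'a \<Rightarrow> real^'q^'p"
  assumes "prob_space P"
    and meas: "\<And>p q. (\<lambda>\<omega>. M \<omega> $ p $ q) \<in> borel_measurable P"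
    and sq: "\<And>p q. integrable P (\<lambda>\<omega>. (M \<omega> $ p $ q)\<^sup>2)"
    and mean: "\<And>p q. prob_space.expectation P (\<lambda>\<omega>. M \<omega> $ p $ q) = Mbar $ p $ q"
    and cov: "cov_matrix P (\<lambda>\<omega>. vectorize (M \<omega>)) = Sig"
  shows "has_moments P (\<lambda>\<omega>. M \<omega> *v v) (Mbar *v v)
    (transpose (kron_col_left v (mat 1)) ** Sig ** kron_col_left v (mat 1))"
proof -
  have "has_moments P (\<lambda>\<omega>. vectorize (M \<omega>))
      (\<chi> i. prob_space.expectation P (\<lambda>\<omega>. vectorize (M \<omega>) $ i)) (cov_matrix P (\<lambda>\<omega>. vectorize (M \<omega>)))"
    by (rule has_moments_square_integrable) (simp_all add: assms(1) vectorize_def meas sq)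
  moreover have "(\<chi> i. prob_space.expectation P (\<lambda>\<omega>. vectorize (M \<omega>) $ i)) = vectorize Mbar"
    by (simp add: vec_eq_iff vectorize_def mean)
  ultimately have "has_moments P (\<lambda>\<omega>. vectorize (M \<omega>)) (vectorize Mbar) Sig"
    by (simp add: cov)
  from has_moments_linear_image[OF this, of "transpose (kron_col_left v (mat 1))"]
  show ?thesis
    unfolding transpose_kron_col_left_vectorize transpose_transpose .
qed

text \<open>The mean of the managed returns is a matrix-valued Bochner integral; passing to its
  entries requires integrability of the whole function.\<close>

lemma integrable_vec:
  fixes f :: "'a \<Rightarrow> 'b::euclidean_space^'k"
  assumes "\<And>i. integrable P (\<lambda>\<omega>. f \<omega> $ i)"
  shows "integrable P f"
proof -
  have "linear (axis i :: 'b \<Rightarrow> 'b^'k)" for i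
    by (rule linearI) (simp_all add: vec_eq_iff axis_def)
  then have "integrable P (\<lambda>\<omega>. axis i (f \<omega> $ i) :: 'b^'k)" for i
    by (intro integrable_bounded_linear[OF _ assms]) (simp add: linear_conv_bounded_linear)
  then have "integrable P (\<lambda>\<omega>. \<Sum>i\<in>UNIV. axis i (f \<omega> $ i))"
    by simp
  also have "(\<lambda>\<omega>. \<Sum>i\<in>UNIV. axis i (f \<omega> $ i)) = f"
    by (simp add: fun_eq_iff vec_eq_iff axis_def)
  finally show ?thesis .
qed

lemma borel_measurable_vec_nth:
  fixes f :: "'a \<Rightarrow> 'b::euclidean_space^'k"
  assumes "f \<in> borel_measurable P"
  shows "(\<lambda>\<omega>. f \<omega> $ i) \<in> borel_measurable P"
  using assms by (rule borel_measurable_continuous_on[rotated]) (intro continuous_intros)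

section \<open>Strategy returns as portfolio returns\<close>

lemma strategy_return_Phi: "strategy_return r S \<Lambda> \<Phi> s \<omega> = (transpose (managed r S s \<omega>) *v \<Phi>) \<bullet> \<Lambda>"
  by (simp only: strategy_return_def inner_commute)

text \<open>The return is bilinear; fixing one parameter exposes the other as weights on managed
  portfolios, here \<open>\<Phi>\<close> and in the preceding form \<open>\<Lambda>\<close>.\<close>

lemma strategy_return_Lambda: "strategy_return r S \<Lambda> \<Phi> s \<omega> = (managed r S s \<omega> *v \<Lambda>) \<bullet> \<Phi>"
  by (metis strategy_return_Phi dot_lmul_matrix inner_commute transpose_matrix_vector)

text \<open>Entry \<open>(i, k)\<close> of \<open>vectorize (transpose \<Psi>)\<close> is
  \<open>\<Psi> $ i $ k\<close>, and it meets the managed return built from the signals of asset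
  \<open>i\<close> and the return of asset \<open>k\<close>.\<close>

lemma strategy_return_portfolio_weights:
  "strategy_return r S \<Lambda> (vectorize (transpose \<Psi>)) s \<omega> = portfolio_weights S \<Lambda> \<Psi> (s - 1) \<omega> \<bullet> r s \<omega>"
proof -
  define z where "z = S (s - 1) \<omega> *v \<Lambda>"
  have "(managed r S s \<omega> *v \<Lambda>) $ p = r s \<omega> $ snd p * z $ fst p" for p
    by (simp add: matrix_vector_mult_def managed_nth z_def sum_distrib_left mult.assoc)
  then have "strategy_return r S \<Lambda> (vectorize (transpose \<Psi>)) s \<omega> =
      (\<Sum>i\<in>UNIV. \<Sum>k\<in>UNIV. r s \<omega> $ k * z $ i * \<Psi> $ i $ k)"
    by (simp add: strategy_return_Lambda inner_vec_def sum_UNIV_prod vectorize_def transpose_def)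
  also have "\<dots> = z \<bullet> (\<Psi> *v r s \<omega>)"
    by (simp add: inner_vec_def matrix_vector_mult_def sum_distrib_left algebra_simps)
  also have "\<dots> = portfolio_weights S \<Lambda> \<Psi> (s - 1) \<omega> \<bullet> r s \<omega>"
    by (simp add: portfolio_weights_def z_def dot_lmul_matrix vector_matrix_mul_assoc[symmetric])
  finally show ?thesis .
qed

lemma chi_Phi_mult: "(chi_Phi r S \<Phi> \<omega> *v \<Lambda>) $ i = strategy_return r S \<Lambda> \<Phi> (date i) \<omega>"
  by (simp add: chi_Phi_def matrix_vector_mul_component strategy_return_Phi)

lemma chi_Lambda_mult: "(chi_Lambda r S \<Lambda> \<omega> *v \<Phi>) $ i = strategy_return r S \<Lambda> \<Phi> (date i) \<omega>"
  by (simp add: chi_Lambda_def matrix_vector_mul_component strategy_return_Lambda)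

theorem proposition5:
  fixes P :: "'a measure"
    and r :: "nat \<Rightarrow> 'a \<Rightarrow> real^'n"
    and S :: "nat \<Rightarrow> 'a \<Rightarrow> real^'m^'n"
    and T :: nat
    and Pbar :: "real^'m^('n \<times> 'n)"
    and SigPhi :: "real^(('n \<times> 'n) \<times> 'm)^(('n \<times> 'n) \<times> 'm)"
    and SigLam :: "real^('m \<times> ('n \<times> 'n))^('m \<times> ('n \<times> 'n))"
    and lam :: real
  assumes "prob_space P"
    and T: "T = CARD('t::{finite, linorder})"
    and "\<And>s. s \<in> {2..T + 1} \<Longrightarrow> r s \<in> borel_measurable P"
    and "\<And>t. t \<in> {1..T} \<Longrightarrow> S t \<in> borel_measurable P"
    and "\<And>s p j. s \<in> {2..T + 1} \<Longrightarrow> integrable P (\<lambda>\<omega>. (managed r S s \<omega> $ p $ j)\<^sup>2)"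
    and "\<And>s. s \<in> {2..T + 1} \<Longrightarrow> prob_space.expectation P (managed r S s) = Pbar"
    and "\<And>s. s \<in> {2..T + 1} \<Longrightarrow> cov_matrix P (\<lambda>\<omega>. vectorize (transpose (managed r S s \<omega>))) = SigPhi"
    and "\<And>s. s \<in> {2..T + 1} \<Longrightarrow> cov_matrix P (\<lambda>\<omega>. vectorize (managed r S s \<omega>)) = SigLam"
    and "lam > 0"
  shows "
    \<comment> \<open>the strategy return, in terms of the portfolio weights\<close>
    (\<forall>s \<in> {2..T + 1}. \<forall>\<omega> \<in> space P. \<forall>\<Lambda> \<Psi>.
       strategy_return r S \<Lambda> (vectorize (transpose \<Psi>)) s \<omega> =
         portfolio_weights S \<Lambda> \<Psi> (s - 1) \<omega> \<bullet> r s \<omega>) \<and>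
    \<comment> \<open>(1), population: eigenvalue problem, squared Sharpe ratio, mean-variance efficiency\<close>
    (\<forall>\<Phi>. invertible (B_Phi SigPhi \<Phi>) \<longrightarrow>
       (\<exists>\<Lambda>. leading_eigenvector (C_Phi Pbar SigPhi \<Phi>) \<Lambda>) \<and>
       (\<forall>s \<in> {2..T + 1}. \<forall>\<Lambda>.
          sq_sharpe P (strategy_return r S \<Lambda> \<Phi> s) =
            (\<Lambda> \<bullet> (A_Phi Pbar \<Phi> *v \<Lambda>)) / (\<Lambda> \<bullet> (B_Phi SigPhi \<Phi> *v \<Lambda>)) \<and>
          (leading_eigenvector (C_Phi Pbar SigPhi \<Phi>) \<Lambda> \<longleftrightarrow>
             maximizes_sq_sharpe P (\<lambda>\<Lambda>. strategy_return r S \<Lambda> \<Phi> s) \<Lambda>) \<and>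
          (transpose Pbar *v \<Phi> \<noteq> 0 \<longrightarrow>
             (leading_eigenvector (C_Phi Pbar SigPhi \<Phi>) \<Lambda> \<longleftrightarrow>
                \<Lambda> \<noteq> 0 \<and>
                (mv_efficient P (\<lambda>\<omega>. transpose (managed r S s \<omega>) *v \<Phi>) \<Lambda> \<or>
                 mv_efficient P (\<lambda>\<omega>. transpose (managed r S s \<omega>) *v \<Phi>) (- \<Lambda>)))))) \<and>
    \<comment> \<open>(1), sample: the regression of a constant on the managed portfolios, and its ridge version\<close>
    (\<forall>\<Phi>. \<forall>\<omega> \<in> space P.
       let X = (chi_Phi r S \<Phi> \<omega> :: real^'m^'t::{finite, linorder}) in
         (\<forall>\<Lambda> i. (X *v \<Lambda>) $ i = strategy_return r S \<Lambda> \<Phi> (date i) \<omega>) \<and>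
         (invertible (sample_cov_matrix X) \<longrightarrow>
            (\<exists>b. (\<forall>\<Lambda>. least_squares ones X \<Lambda> \<longleftrightarrow> \<Lambda> = b) \<and>
                 (\<forall>\<Lambda>. sample_mv_efficient X \<Lambda> \<longleftrightarrow> (\<exists>c \<ge> 0. \<Lambda> = c *\<^sub>R b)))) \<and>
         invertible (transpose X ** X + lam *\<^sub>R mat 1) \<and>
         (\<forall>\<Lambda>. ridge_regression lam ones X \<Lambda> \<longleftrightarrow> \<Lambda> = ridge_estimator lam X) \<and>
         (transpose X *v ones \<noteq> 0 \<longrightarrow>
            (\<forall>\<Lambda>. least_squares ones X \<Lambda> \<longrightarrow> norm (ridge_estimator lam X) < norm \<Lambda>) \<and>
            (\<forall>lam' > lam. norm (ridge_estimator lam' X) < norm (ridge_estimator lam X))) \<and>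
         ((\<lambda>lam'. ridge_estimator lam' X) \<longlongrightarrow> 0) at_top) \<and>
    \<comment> \<open>(2), population\<close>
    (\<forall>\<Lambda>. invertible (B_Lambda SigLam \<Lambda>) \<longrightarrow>
       (\<exists>\<Phi>. leading_eigenvector (C_Lambda Pbar SigLam \<Lambda>) \<Phi>) \<and>
       (\<forall>s \<in> {2..T + 1}. \<forall>\<Phi>.
          sq_sharpe P (strategy_return r S \<Lambda> \<Phi> s) =
            (\<Phi> \<bullet> (A_Lambda Pbar \<Lambda> *v \<Phi>)) / (\<Phi> \<bullet> (B_Lambda SigLam \<Lambda> *v \<Phi>)) \<and>
          (leading_eigenvector (C_Lambda Pbar SigLam \<Lambda>) \<Phi> \<longleftrightarrow>
             maximizes_sq_sharpe P (\<lambda>\<Phi>. strategy_return r S \<Lambda> \<Phi> s) \<Phi>) \<and>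
          (Pbar *v \<Lambda> \<noteq> 0 \<longrightarrow>
             (leading_eigenvector (C_Lambda Pbar SigLam \<Lambda>) \<Phi> \<longleftrightarrow>
                \<Phi> \<noteq> 0 \<and>
                (mv_efficient P (\<lambda>\<omega>. managed r S s \<omega> *v \<Lambda>) \<Phi> \<or>
                 mv_efficient P (\<lambda>\<omega>. managed r S s \<omega> *v \<Lambda>) (- \<Phi>)))))) \<and>
    \<comment> \<open>(2), sample\<close>
    (\<forall>\<Lambda>. \<forall>\<omega> \<in> space P.
       let X = (chi_Lambda r S \<Lambda> \<omega> :: real^('n \<times> 'n)^'t::{finite, linorder}) in
         (\<forall>\<Phi> i. (X *v \<Phi>) $ i = strategy_return r S \<Lambda> \<Phi> (date i) \<omega>) \<and>
         (invertible (sample_cov_matrix X) \<longrightarrow>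
            (\<exists>b. (\<forall>\<Phi>. least_squares ones X \<Phi> \<longleftrightarrow> \<Phi> = b) \<and>
                 (\<forall>\<Phi>. sample_mv_efficient X \<Phi> \<longleftrightarrow> (\<exists>c \<ge> 0. \<Phi> = c *\<^sub>R b)))) \<and>
         invertible (transpose X ** X + lam *\<^sub>R mat 1) \<and>
         (\<forall>\<Phi>. ridge_regression lam ones X \<Phi> \<longleftrightarrow> \<Phi> = ridge_estimator lam X) \<and>
         (transpose X *v ones \<noteq> 0 \<longrightarrow>
            (\<forall>\<Phi>. least_squares ones X \<Phi> \<longrightarrow> norm (ridge_estimator lam X) < norm \<Phi>) \<and>
            (\<forall>lam' > lam. norm (ridge_estimator lam' X) < norm (ridge_estimator lam X))) \<and>
         ((\<lambda>lam'. ridge_estimator lam' X) \<longlongrightarrow> 0) at_top)"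
proof -
  interpret prob_space P by fact
  have managed_meas: "(\<lambda>\<omega>. managed r S s \<omega> $ p $ j) \<in> borel_measurable P" if "s \<in> {2..T + 1}" for s p j
  proof -
    \<comment> \<open>Return dates in \<open>{2..T + 1}\<close> use signals dated
      \<open>{1..T}\<close>.\<close>
    have "S (s - 1) \<in> borel_measurable P"
      using that by (intro assms(4)) auto
    then show ?thesis
      unfolding managed_nth using assms(3)[OF that]
      by (intro borel_measurable_times borel_measurable_vec_nth)
  qed
  note managed_sq = assms(5)
  have managed_mean: "expectation (\<lambda>\<omega>. managed r S s \<omega> $ p $ j) = Pbar $ p $ j" if s: "s \<in> {2..T + 1}" for s p j
  proof -
    have int: "integrable P (managed r S s)"
      by (intro integrable_vec) (rule square_integrable_imp_integrable[OF managed_meas managed_sq]; fact s)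
    have "bounded_linear (\<lambda>M :: real^'m^('n \<times> 'n). M $ p $ j)"
      by (rule bounded_linear_compose[OF bounded_linear_vec_nth bounded_linear_vec_nth])
    from integral_bounded_linear[OF this int] show ?thesis
      by (simp add: assms(6)[OF s])
  qed
  have mom_Phi: "has_moments P (\<lambda>\<omega>. transpose (managed r S s \<omega>) *v \<Phi>) (transpose Pbar *v \<Phi>) (B_Phi SigPhi \<Phi>)"
    if s: "s \<in> {2..T + 1}" for s \<Phi>
    unfolding B_Phi_def
    by (rule has_moments_matrix_mult)
      (use s in \<open>simp_all add: transpose_def managed_meas managed_sq managed_mean prob_space_axioms
        flip: assms(7)[OF s]\<close>)
  have mom_Lambda: "has_moments P (\<lambda>\<omega>. managed r S s \<omega> *v \<Lambda>) (Pbar *v \<Lambda>) (B_Lambda SigLam \<Lambda>)"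
    if s: "s \<in> {2..T + 1}" for s \<Lambda>
    unfolding B_Lambda_def
    by (rule has_moments_matrix_mult)
      (use s in \<open>simp_all add: managed_meas managed_sq managed_mean prob_space_axioms assms(8)\<close>)
  have A_Phi: "A_Phi Pbar \<Phi> = outer (transpose Pbar *v \<Phi>)" for \<Phi>
    using outer_mult_left[of "transpose Pbar" \<Phi>] by (simp add: A_Phi_def)
  have A_Lambda: "A_Lambda Pbar \<Lambda> = outer (Pbar *v \<Lambda>)" for \<Lambda>
    by (simp only: A_Lambda_def outer_mult_left)
  \<comment> \<open>The existence claims mention no date, so one must be supplied;
    \<open>T \<ge> 1\<close> because a type is nonempty.\<close>
  have two: "2 \<in> {2..T + 1}"
    using T by (simp add: Suc_le_eq)
  note char_Phi = leading_eigenvector_characterization[OF mom_Phi, folded A_Phi, folded C_Phi_def]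
  note char_Lambda = leading_eigenvector_characterization[OF mom_Lambda, folded A_Lambda, folded C_Lambda_def]
  have return_Phi: "strategy_return r S \<Lambda> \<Phi> s = (\<lambda>\<omega>. (transpose (managed r S s \<omega>) *v \<Phi>) \<bullet> \<Lambda>)" for \<Lambda> \<Phi> s
    by (rule ext) (rule strategy_return_Phi)
  have return_Lambda: "strategy_return r S \<Lambda> \<Phi> s = (\<lambda>\<omega>. (managed r S s \<omega> *v \<Lambda>) \<bullet> \<Phi>)" for \<Lambda> \<Phi> s
    by (rule ext) (rule strategy_return_Lambda)
  \<comment> \<open>These facts hold for any data matrix and serve both regressions.\<close>
  note sample = least_squares_ones_mv_efficient pos_def_invertible[OF pos_def_ridge[OF \<open>lam > 0\<close>]]
    ridge_regression_iff[OF \<open>lam > 0\<close>] ridge_shrinkage[OF \<open>lam > 0\<close>] ridge_estimator_tendsto_0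
  show ?thesis
  \<comment> \<open>Goal 1 is the weight formula; goals 2 to 5 are the population and goal 6 the
    sample claims for \<open>\<Lambda>\<close>; goals 7 to 11 repeat this for
    \<open>\<Phi>\<close>.\<close>
  proof (intro conjI allI ballI impI, goal_cases)
    case 1
    show ?case by (rule strategy_return_portfolio_weights)
  next
    case 2
    then show ?case by (rule char_Phi(1)[OF two])
  next
    case 3
    then show ?case unfolding return_Phi by (rule char_Phi(2)[rotated])
  next
    case 4
    then show ?case unfolding return_Phi by (rule char_Phi(3)[rotated])
  next
    case 5
    then show ?case by (intro char_Phi(4))
  next
    case 6
    show ?case unfolding Let_def by (intro conjI allI impI chi_Phi_mult sample)
  next
    case 7
    then show ?case by (rule char_Lambda(1)[OF two])
  next
    case 8
    then show ?case unfolding return_Lambda by (rule char_Lambda(2)[rotated])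
  next
    case 9
    then show ?case unfolding return_Lambda by (rule char_Lambda(3)[rotated])
  next
    case 10
    then show ?case by (intro char_Lambda(4))
  next
    case 11
    show ?case unfolding Let_def by (intro conjI allI impI chi_Lambda_mult sample)
  qed
qed

end
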